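(* Let $k>0$ and $\alpha>0$ be integers. Then: (1) $U^{k}(\mathbb{Z}_{2^{\alpha}})\approx \mathbb{Z}_{2}\times\mathbb{Z}_{2^{\alpha-2k}}$ if $\alpha>2k$; (2) $U^{k}(\mathbb{Z}_{2^{\alpha}})\approx \mathbb{Z}_{2}$ if $\alpha=2k$; (3) $U^{k}(\mathbb{Z}_{2^{\alpha}})\approx \{0\}$ if $\alpha<2k$.
   Context: For an integer $n\ge 1$, $\mathbb{Z}_n$ is the ring of integers modulo $n$ ($\mathbb{Z}_1=\{0\}$). For a finite commutative ring $R$ with identity (the zero ring is allowed, with $U(\{0\})=\{0\}$), $U(R)$ is its group of units. Since $U(R)$ is a finite abelian group, it is isomorphic to a product $\mathbb{Z}_{n_1}\times\cdots\times\mathbb{Z}_{n_i}$ of cyclic groups, and $U(R)$ is regarded as a ring by transporting the ring structure of $\mathbb{Z}_{n_1}\oplus\cdots\oplus\mathbb{Z}_{n_i}$ (up to ring isomorphism this does not depend on the chosen decomposition). The $k$-th (generalized) group of units is defined by $U^0(R)=R$, $U^1(R)=U(R)$ and $U^k(R)=U(U^{k-1}(R))$, where $U^{k-1}(R)$ is viewed as a ring in this way. The symbol $\approx$ denotes isomorphism (as groups, equivalently as rings with these structures). $\{0\}$ is the trivial group (ring). *)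

theory Defs
  imports "HOL-Algebra.Algebra"
begin

(* S is the group of units of R, regarded as a ring: the addition of S is the
   multiplication of R, and S is isomorphic, as a ring, to a product of rings Z_n.
   Such an isomorphism is in particular a group isomorphism from the units of R onto
   the additive group of the product, and the multiplication of S is the one transported
   along it. S depends on the chosen decomposition, so this is a relation rather than a
   function. "ZFact 1" (= Z_1) and the empty product are both the zero ring. The condition
   "cring S" is needed because ring isomorphisms in HOL-Algebra do not by themselves force
   the source to be closed under its operations. *)
definition unit_ring :: "'a ring \<Rightarrow> 'a ring \<Rightarrow> bool" where
  "unit_ring R S \<longleftrightarrow>
     cring S \<and> add_monoid S = units_of R \<and>
     (\<exists>ns :: nat list. (\<forall>n\<in>set ns. n \<ge> 1) \<and>
        S \<simeq> RDirProd_list (map (\<lambda>n. ZFact (int n)) ns))"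

(* "iterated_unit_ring k R S" says that S is a k-th generalized group of units U^k(R), with
   one of its ring structures. *)
primrec iterated_unit_ring :: "nat \<Rightarrow> 'a ring \<Rightarrow> 'a ring \<Rightarrow> bool" where
  "iterated_unit_ring 0 R S \<longleftrightarrow> S = R"
| "iterated_unit_ring (Suc k) R S \<longleftrightarrow> (\<exists>T. iterated_unit_ring k R T \<and> unit_ring T S)"

end

theory Submission
  imports Defs "HOL-Number_Theory.Pocklington"
begin

text \<open>
  Every residue that is prime to $2^m$, where $m \ge 2$, is $\pm 5^j$ with the sign unique and
  $j$ unique modulo $2^{m-2}$: modulo 4 only the sign is visible, and 5 has order $2^{m-2}$, so
  these $2^{m-1}$ residues are distinct and exhaust the units. Hence
  $U(\mathbb{Z}_{2^m}) \approx \mathbb{Z}_2 \times \mathbb{Z}_{2^{m-2}}$, while the group is trivial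
  for $m < 2$ (\<open>units_ZFact_twopow_iso\<close>). The units of this product ring are
  those of the second factor, because $\mathbb{Z}_2$ has only one
  (\<open>units_twopow_units_ring\<close>). So each application of $U$ lowers the exponent by 2, and the
  sign factor that it creates disappears at the next application.

  The iteration is through rings, so the additive group has to determine the ring structure that
  is chosen on it. For a product of rings $\mathbb{Z}_n$ whose additive group is
  $\mathbb{Z}_2 \times \mathbb{Z}_{2^e}$, two invariants of that group suffice: the order is the
  product of the moduli, and a number kills the group exactly if every modulus divides it. If
  $e \ge 1$, the second invariant forces one modulus to be $2^e$; the remaining ones then have
  product 2, so one of them is 2 and the others are 1. If $e = 0$, the order is 2 and leaves the
  same conclusion (\<open>residue_product_eq_twopow_units_ring\<close>).

  Subtraction of natural numbers is truncated, and the exponents $m - 2$ and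
  $\alpha - 2k$ below rely on it: once the exponent would become negative it stays 0, and
  $\mathbb{Z}_{2^0}$ is the zero ring, which is what $U$ produces from then on.
\<close>

section \<open>The rings of residues\<close>

lemma ZMod_ring_hom: "ZMod n \<in> ring_hom \<Z> (ZFact n)"
proof -
  interpret ideal "Idl\<^bsub>\<Z>\<^esub> {n}" \<Z>
    by (rule int.genideal_ideal) simp
  have "(+>\<^bsub>\<Z>\<^esub>) (Idl\<^bsub>\<Z>\<^esub> {n}) \<in> ring_hom \<Z> (\<Z> Quot (Idl\<^bsub>\<Z>\<^esub> {n}))"
    by (rule rcos_ring_hom)
  moreover have "ZMod n = (+>\<^bsub>\<Z>\<^esub>) (Idl\<^bsub>\<Z>\<^esub> {n})"
    by (rule ext) (simp add: ZMod_def)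
  ultimately show ?thesis
    by (simp add: ZFact_def)
qed

lemma ZFact_mult: "ZMod n a \<otimes>\<^bsub>ZFact n\<^esub> ZMod n b = ZMod n (a * b)"
  using ring_hom_mult[OF ZMod_ring_hom, of a b n] by simp

lemma ZFact_add: "ZMod n a \<oplus>\<^bsub>ZFact n\<^esub> ZMod n b = ZMod n (a + b)"
  using ring_hom_add[OF ZMod_ring_hom, of a b n] by simp

lemma ZFact_one_eq: "\<one>\<^bsub>ZFact n\<^esub> = ZMod n 1"
  using ring_hom_one[OF ZMod_ring_hom, of n] by simp

lemma ZFact_zero_eq: "\<zero>\<^bsub>ZFact n\<^esub> = ZMod n 0"
  using ring_hom_zero[OF ZMod_ring_hom, of n] int.ring_axioms
    cring.axioms(1)[OF ZFact_is_cring[of n]] by simp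

lemma ZFact_carrier: "carrier (ZFact n) = range (ZMod n)"
  by (auto simp: ZFact_def FactRing_def A_RCOSETS_def' ZMod_def)

lemma ZMod_eq_cong: "ZMod n a = ZMod n b \<longleftrightarrow> [a = b] (mod n)"
  by (simp add: ZMod_eq_mod cong_def)

lemma ZFact_ring: "ring (ZFact n)"
  using ZFact_is_cring cring.axioms(1) by blast

text \<open>
  Nonnegative representatives suffice. They are used where a residue serves as an exponent, and
  where facts about \<^const>\<open>totient\<close> and multiplicative orders of natural numbers apply.
\<close>
lemma ZFact_carrier_nat:
  assumes "n \<ge> 1"
  shows "carrier (ZFact (int n)) = range (\<lambda>x::nat. ZMod (int n) (int x))"
proof -
  have "ZMod (int n) a \<in> range (\<lambda>x::nat. ZMod (int n) (int x))" for a
  proof -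
    have "ZMod (int n) a = ZMod (int n) (int (nat (a mod int n)))"
      using assms by (simp add: ZMod_eq_mod)
    then show ?thesis by blast
  qed
  then show ?thesis by (auto simp: ZFact_carrier)
qed

lemma card_ZFact:
  assumes "n \<ge> 1"
  shows "card (carrier (ZFact (int n))) = n"
proof -
  have "carrier (ZFact (int n)) = (\<lambda>x. ZMod (int n) (int x)) ` {..<n}"
  proof -
    have "ZMod (int n) (int x) \<in> (\<lambda>x. ZMod (int n) (int x)) ` {..<n}" for x
      using assms by (intro image_eqI[of _ _ "x mod n"]) (auto simp: ZMod_eq_mod zmod_int)
    then show ?thesis
      unfolding ZFact_carrier_nat[OF assms] by auto
  qed
  moreover have "inj_on (\<lambda>x. ZMod (int n) (int x)) {..<n}"
    by (auto simp: inj_on_def ZMod_eq_mod)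
  ultimately show ?thesis
    by (simp add: card_image)
qed

lemma ZMod_mem_Units_iff: "ZMod n a \<in> Units (ZFact n) \<longleftrightarrow> coprime a n"
proof
  assume "ZMod n a \<in> Units (ZFact n)"
  then obtain b where "[b * a = 1] (mod n)"
    by (auto simp: Units_def ZFact_carrier ZFact_mult ZFact_one_eq ZMod_eq_cong)
  then show "coprime a n"
    by (metis coprime_iff_invertible_int mult.commute)
next
  assume "coprime a n"
  then obtain b where "[a * b = 1] (mod n)"
    using coprime_iff_invertible_int by blast
  then show "ZMod n a \<in> Units (ZFact n)"
    by (auto simp: Units_def ZFact_carrier ZFact_mult ZFact_one_eq ZMod_eq_cong mult.commute)
qed

lemma Units_ZFact_eq_one:
  assumes "n = 1 \<or> n = 2"
  shows "Units (ZFact n) = {\<one>\<^bsub>ZFact n\<^esub>}"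
proof -
  have "[a = 1] (mod n)" if "coprime a n" for a
    using assms that by (auto simp: cong_def odd_iff_mod_2_eq_one)
  have "A = \<one>\<^bsub>ZFact n\<^esub>" if A: "A \<in> Units (ZFact n)" for A
  proof -
    obtain a where a: "A = ZMod n a"
      using A unfolding Units_def ZFact_carrier by blast
    have "[a = 1] (mod n)"
      by (rule \<open>\<And>a. coprime a n \<Longrightarrow> [a = 1] (mod n)\<close>) (use A a ZMod_mem_Units_iff in blast)
    then show ?thesis
      by (simp add: a ZFact_one_eq ZMod_eq_cong)
  qed
  then show ?thesis
    using monoid.Units_one_closed[OF ring.is_monoid[OF ZFact_ring]] by blast
qed

text \<open>
  The set \<^term>\<open>totatives n\<close> lies in $\{1, \ldots, n\}$, whereas reduction modulo $n$ lands
  in $\{0, \ldots, n - 1\}$. The two ranges disagree on coprime representatives only for $n = 1$.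
\<close>
lemma card_Units_ZFact:
  assumes "n \<ge> 1"
  shows "card (Units (ZFact (int n))) = totient n"
proof -
  have "Units (ZFact (int n)) = (\<lambda>x. ZMod (int n) (int x)) ` totatives n"
  proof (intro equalityI subsetI)
    fix A assume A: "A \<in> Units (ZFact (int n))"
    then obtain x where x: "A = ZMod (int n) (int x)"
      using ZFact_carrier_nat[OF assms] unfolding Units_def by auto
    have cop: "coprime x n"
      using A ZMod_mem_Units_iff by (simp add: x)
    show "A \<in> (\<lambda>x. ZMod (int n) (int x)) ` totatives n"
    proof (cases "n = 1")
      case True
      then show ?thesis by (auto simp: x ZMod_eq_mod)
    next
      case False
      then have "x mod n > 0"
        using cop by (metis assms coprime_absorb_right gr0I mod_0_imp_dvd nat_dvd_1_iff_1)
      then have "x mod n \<in> totatives n"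
        using cop assms by (auto simp: totatives_def less_imp_le)
      then show ?thesis
        by (intro image_eqI[of _ _ "x mod n"]) (auto simp: x ZMod_eq_mod zmod_int)
    qed
  next
    fix A assume "A \<in> (\<lambda>x. ZMod (int n) (int x)) ` totatives n"
    then show "A \<in> Units (ZFact (int n))"
      by (auto simp: ZMod_mem_Units_iff totatives_def)
  qed
  moreover have "inj_on (\<lambda>x. ZMod (int n) (int x)) (totatives n)"
  proof (rule inj_onI)
    fix x y assume "x \<in> totatives n" "y \<in> totatives n" "ZMod (int n) (int x) = ZMod (int n) (int y)"
    then show "x = y"
      by (cases "x = n"; cases "y = n")
         (auto simp: ZMod_eq_cong cong_int_iff totatives_def cong_def)
  qed
  ultimately show ?thesis
    by (simp add: card_image totient_def)
qed

section \<open>Isomorphisms\<close>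

text \<open>
  If two groups are images of the same set under parametrizations that identify the same points,
  then matching equal parameters is an isomorphism. This avoids choosing representatives of
  residue classes and checking independence of the choice.
\<close>
lemma iso_if_common_parametrization:
  fixes p :: "'x \<Rightarrow> 'a" and q :: "'x \<Rightarrow> 'b"
  assumes "carrier G = range p" and "carrier H = range q"
    and same: "\<And>x y. p x = p y \<longleftrightarrow> q x = q y"
    and p: "\<And>x y. p (f x y) = p x \<otimes>\<^bsub>G\<^esub> p y"
    and q: "\<And>x y. q (f x y) = q x \<otimes>\<^bsub>H\<^esub> q y"
  shows "G \<cong> H"
proof -
  define h where "h a = q (inv_into UNIV p a)" for a
  have h: "h (p x) = q x" for x
    unfolding h_def using same by (metis f_inv_into_f rangeI)
  have "h \<in> hom G H"
    using assms(1,2) by (auto simp: hom_def h simp flip: p q)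
  moreover have "bij_betw h (carrier G) (carrier H)"
    using assms(1,2) same by (auto simp: bij_betw_def inj_on_def h image_image)
  ultimately show ?thesis
    by (auto simp: is_iso_def iso_def)
qed

lemma RDirProd_mult: "(a, b) \<otimes>\<^bsub>RDirProd R S\<^esub> (c, d) = (a \<otimes>\<^bsub>R\<^esub> c, b \<otimes>\<^bsub>S\<^esub> d)"
  and RDirProd_one: "\<one>\<^bsub>RDirProd R S\<^esub> = (\<one>\<^bsub>R\<^esub>, \<one>\<^bsub>S\<^esub>)"
  and RDirProd_add: "(a, b) \<oplus>\<^bsub>RDirProd R S\<^esub> (c, d) = (a \<oplus>\<^bsub>R\<^esub> c, b \<oplus>\<^bsub>S\<^esub> d)"
  by (auto simp: RDirProd_def DirProd_def monoid.defs)

lemma RDirProd_cring: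
  assumes "cring R" "cring S"
  shows "cring (RDirProd R S)"
proof -
  interpret R: cring R by fact
  interpret S: cring S by fact
  interpret P: ring "RDirProd R S"
    by (rule RDirProd_ring) (rule R.ring_axioms S.ring_axioms)+
  show ?thesis
    by unfold_locales (auto simp: RDirProd_carrier RDirProd_mult R.m_comm S.m_comm)
qed

lemma Units_RDirProd: "Units (RDirProd R S) = Units R \<times> Units S"
  by (fastforce simp: Units_def RDirProd_carrier RDirProd_mult RDirProd_one)

text \<open>
  An isomorphism of rings maps units onto units, because inverses can be pulled back along it.
  This lets the units of an abstract ring be computed in a concrete model of it.
\<close>
lemma ring_iso_imp_units_iso:
  assumes "ring R" "ring S" "R \<simeq> S"
  shows "units_of R \<cong> units_of S"
proof -
  interpret R: ring R by fact
  interpret S: ring S by fact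
  obtain h where h: "h \<in> ring_iso R S"
    using assms(3) by (auto simp: is_ring_iso_def)
  note hE = ring_iso_memE[OF h]
  have inj: "inj_on h (carrier R)" and surj: "h ` carrier R = carrier S"
    using hE(5) by (auto simp: bij_betw_def)
  have "h ` Units R = Units S"
  proof (intro equalityI subsetI)
    fix y assume "y \<in> h ` Units R"
    then show "y \<in> Units S"
      using hE(1) by (auto simp: Units_def simp flip: hE(2,4)) (metis hE(2,4))
  next
    fix y assume y: "y \<in> Units S"
    then obtain z where z: "z \<in> carrier S" "z \<otimes>\<^bsub>S\<^esub> y = \<one>\<^bsub>S\<^esub>" "y \<otimes>\<^bsub>S\<^esub> z = \<one>\<^bsub>S\<^esub>" "y \<in> carrier S"
      by (auto simp: Units_def)
    then obtain a b where ab: "a \<in> carrier R" "h a = y" "b \<in> carrier R" "h b = z"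
      using surj by (metis imageE)
    have "h (b \<otimes>\<^bsub>R\<^esub> a) = h \<one>\<^bsub>R\<^esub>" "h (a \<otimes>\<^bsub>R\<^esub> b) = h \<one>\<^bsub>R\<^esub>"
      using ab z by (simp_all add: hE(2,4))
    then have "b \<otimes>\<^bsub>R\<^esub> a = \<one>\<^bsub>R\<^esub>" "a \<otimes>\<^bsub>R\<^esub> b = \<one>\<^bsub>R\<^esub>"
      using inj ab by (auto dest: inj_onD)
    then show "y \<in> h ` Units R"
      using ab by (auto simp: Units_def)
  qed
  then have "bij_betw h (Units R) (Units S)"
    using inj_on_subset[OF inj, of "Units R"] by (auto simp: bij_betw_def Units_def)
  then have "h \<in> iso (units_of R) (units_of S)"
    using hE(2) R.Units_closed by (auto simp: iso_def hom_def units_of_def bij_betw_def)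
  then show ?thesis
    by (auto simp: is_iso_def)
qed

lemma ring_iso_imp_add_iso:
  assumes "R \<simeq> S"
  shows "add_monoid R \<cong> add_monoid S"
  using assms by (auto simp: is_ring_iso_def ring_iso_def is_iso_def iso_def hom_def ring_hom_def)

lemma units_RDirProd_iso:
  assumes "Units R = {\<one>\<^bsub>R\<^esub>}" and "\<one>\<^bsub>R\<^esub> \<otimes>\<^bsub>R\<^esub> \<one>\<^bsub>R\<^esub> = \<one>\<^bsub>R\<^esub>"
  shows "units_of (RDirProd R S) \<cong> units_of S"
proof -
  have "snd \<in> iso (units_of (RDirProd R S)) (units_of S)"
    using assms 
    by (auto simp: iso_def hom_def units_of_def Units_RDirProd RDirProd_mult bij_betw_def inj_on_def)
  then show ?thesis
    by (auto simp: is_iso_def)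
qed


section \<open>The units of the integers modulo a power of two\<close>

text \<open>
  A ring whose additive group is the group of units modulo $2^m$. For $m < 2$ both factors are the
  zero ring. Keeping the shape of a product there allows all $m$ to be treated alike.
\<close>
definition twopow_units_ring :: "nat \<Rightarrow> (int set \<times> int set) ring" where
  "twopow_units_ring m =
     RDirProd (ZFact (int (if m \<ge> 2 then 2 else 1))) (ZFact (int (2 ^ (m - 2))))"

lemma ord_5_modulo_twopow:
  assumes "m \<ge> 2"
  shows "ord (2 ^ m) (5 :: nat) = 2 ^ (m - 2)"
proof (cases "m = 2")
  case True
  have "ord 4 (5 :: nat) = 1"
    using ord_eq_Suc_0_iff[of 4 5] by (simp add: cong_def)
  with True show ?thesis by simp
next
  case False
  with assms show ?thesis by (intro ord_twopow_3_5) auto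
qed

text \<open>
  Since $5 \equiv 1$ modulo 4, reduction modulo 4 recovers the sign. After the sign is cancelled,
  the order of 5 decides when the powers agree.
\<close>
lemma signed_power_of_5_cong_iff:
  assumes m: "m \<ge> 2"
  shows "[(-1) ^ i * 5 ^ j = (-1) ^ i' * (5 :: int) ^ j'] (mod 2 ^ m) \<longleftrightarrow>
           [i = i'] (mod 2) \<and> [j = j'] (mod 2 ^ (m - 2))"
proof -
  have five: "[5 ^ j = (5 :: int) ^ j'] (mod 2 ^ m) \<longleftrightarrow> [j = j'] (mod 2 ^ (m - 2))" for j j'
  proof -
    have "[5 ^ j = (5 :: int) ^ j'] (mod 2 ^ m) \<longleftrightarrow> [5 ^ j = (5 :: nat) ^ j'] (mod 2 ^ m)"
      using cong_int_iff[of "5 ^ j" "5 ^ j'" "2 ^ m"] by simp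
    also have "\<dots> \<longleftrightarrow> [j = j'] (mod ord (2 ^ m) (5 :: nat))"
      by (rule order_divides_expdiff) simp
    finally show ?thesis
      by (simp add: ord_5_modulo_twopow[OF m])
  qed
  have sign: "(-1 :: int) ^ i = (-1) ^ i' \<longleftrightarrow> [i = i'] (mod 2)" for i i' :: nat
    by (cases "even i"; cases "even i'") (auto simp: cong_def even_iff_mod_2_eq_zero odd_iff_mod_2_eq_one)
  show ?thesis
  proof
    assume *: "[(-1) ^ i * 5 ^ j = (-1) ^ i' * (5 :: int) ^ j'] (mod 2 ^ m)"
    have "(4 :: int) dvd 2 ^ m"
      using le_imp_power_dvd[OF m, of "2 :: int"] by simp
    with * have "[(-1) ^ i * 5 ^ j = (-1) ^ i' * (5 :: int) ^ j'] (mod 4)"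
      by (rule cong_dvd_modulus)
    moreover have "[(-1) ^ i * 5 ^ j = (-1) ^ i * (1 :: int)] (mod 4)" for i j :: nat
      using cong_pow[of 5 1 "4 :: int" j] by (intro cong_mult cong_refl) (simp add: cong_def)
    ultimately have "[(-1) ^ i = (-1 :: int) ^ i'] (mod 4)"
      by (metis cong_sym cong_trans mult.right_neutral)
    then have eq: "(-1 :: int) ^ i = (-1) ^ i'"
      by (cases "even i"; cases "even i'") (auto simp: cong_def)
    then have "[5 ^ j = (5 :: int) ^ j'] (mod 2 ^ m)"
      using * by (cases "even i'") (auto simp: cong_minus_minus_iff)
    with eq show "[i = i'] (mod 2) \<and> [j = j'] (mod 2 ^ (m - 2))"
      by (simp add: sign five)
  next
    assume "[i = i'] (mod 2) \<and> [j = j'] (mod 2 ^ (m - 2))"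
    then show "[(-1) ^ i * 5 ^ j = (-1) ^ i' * (5 :: int) ^ j'] (mod 2 ^ m)"
      by (intro cong_mult) (simp_all add: five flip: sign)
  qed
qed

text \<open>
  The pairs $(i, j)$ parametrize both groups, the units through $(-1)^i 5^j$. That all units are
  reached is a matter of counting: the signed powers form a set of the same size as the product
  ring, namely $2^{m-1}$, which is the number of units.
\<close>
lemma units_ZFact_twopow_iso_big:
  assumes m: "m \<ge> 2"
  shows "add_monoid (twopow_units_ring m) \<cong> units_of (ZFact (int (2 ^ m)))"
proof -
  define p where "p = (\<lambda>(i :: nat, j :: nat). (ZMod 2 (int i), ZMod (2 ^ (m - 2)) (int j)))"
  define q where "q = (\<lambda>(i :: nat, j :: nat). ZMod (2 ^ m) ((-1) ^ i * 5 ^ j))"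
  have ring_eq: "twopow_units_ring m = RDirProd (ZFact 2) (ZFact (2 ^ (m - 2)))"
    using m by (simp add: twopow_units_ring_def)
  have p: "carrier (twopow_units_ring m) = range p"
    using ZFact_carrier_nat[of 2] ZFact_carrier_nat[of "2 ^ (m - 2)"]
    by (auto simp: ring_eq RDirProd_carrier p_def)
  have same: "p x = p y \<longleftrightarrow> q x = q y" for x y
    using cong_int_iff[of _ _ 2] cong_int_iff[of _ _ "2 ^ (m - 2)"]
    by (cases x; cases y) (simp add: p_def q_def ZMod_eq_cong signed_power_of_5_cong_iff[OF m])
  have sub: "range q \<subseteq> Units (ZFact (2 ^ m))"
    by (auto simp: q_def ZMod_mem_Units_iff)
  have "card (range q) = card (range p)"
  proof -
    have q_eq: "q (inv_into UNIV p (p x)) = q x" for x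
      using same by (metis f_inv_into_f rangeI)
    have "bij_betw (\<lambda>a. q (inv_into UNIV p a)) (range p) (range q)"
      unfolding bij_betw_def inj_on_def image_image q_eq by (auto simp: q_eq same)
    then show ?thesis
      by (simp add: bij_betw_same_card)
  qed
  also have "\<dots> = 2 * 2 ^ (m - 2)"
    using card_ZFact[of 2] card_ZFact[of "2 ^ (m - 2)"]
    by (simp flip: p add: ring_eq RDirProd_carrier card_cartesian_product)
  also have "\<dots> = 2 ^ (m - 1)"
    using m by (simp flip: power_Suc)
  also have "\<dots> = card (Units (ZFact (2 ^ m)))"
    using card_Units_ZFact[of "2 ^ m"] m by (simp add: totient_prime_power)
  finally have "card (range q) = card (Units (ZFact (2 ^ m)))" .
  moreover have "finite (Units (ZFact (2 ^ m)))"
    using card_Units_ZFact[of "2 ^ m"] by (intro card_ge_0_finite) simp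
  ultimately have q: "Units (ZFact (2 ^ m)) = range q"
    using sub card_subset_eq by metis
  show ?thesis
  proof (rule iso_if_common_parametrization[where p = p and q = q and
        f = "\<lambda>(i, j) (i', j'). (i + i', j + j')"])
    show "carrier (units_of (ZFact (int (2 ^ m)))) = range q"
      using q by (simp add: units_of_def)
    show "carrier (add_monoid (twopow_units_ring m)) = range p"
      using p by simp
    show "p x = p y \<longleftrightarrow> q x = q y" for x y
      by (rule same)
    show "p ((case x of (i, j) \<Rightarrow> \<lambda>(i', j'). (i + i', j + j')) y) =
        p x \<otimes>\<^bsub>add_monoid (twopow_units_ring m)\<^esub> p y" for x y
      by (cases x; cases y) (simp add: p_def ring_eq RDirProd_add ZFact_add del: RDirProd_add_monoid)
    show "q ((case x of (i, j) \<Rightarrow> \<lambda>(i', j'). (i + i', j + j')) y) =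
        q x \<otimes>\<^bsub>units_of (ZFact (int (2 ^ m)))\<^esub> q y" for x y
      by (cases x; cases y) (simp add: q_def units_of_def ZFact_mult power_add mult_ac)
  qed
qed


text \<open>For $m < 2$ both groups are trivial: modulo 1 and modulo 2 the only unit is 1.\<close>
lemma units_ZFact_twopow_iso:
  "add_monoid (twopow_units_ring m) \<cong> units_of (ZFact (int (2 ^ m)))"
proof (cases "m \<ge> 2")
  case True
  then show ?thesis by (rule units_ZFact_twopow_iso_big)
next
  case False
  have "ZMod 1 a = ZMod 1 0" for a
    by (simp add: ZMod_eq_mod)
  then have Z: "carrier (ZFact 1) = {\<zero>\<^bsub>ZFact 1\<^esub>}"
    unfolding ZFact_carrier ZFact_zero_eq by blast
  have Z': "\<zero>\<^bsub>ZFact 1\<^esub> \<oplus>\<^bsub>ZFact 1\<^esub> \<zero>\<^bsub>ZFact 1\<^esub> = \<zero>\<^bsub>ZFact 1\<^esub>"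
    by (simp add: ZFact_zero_eq ZFact_add)
  have U: "Units (ZFact (int (2 ^ m))) = {\<one>\<^bsub>ZFact (int (2 ^ m))\<^esub>}"
    using False by (intro Units_ZFact_eq_one) (auto simp: not_le less_2_cases_iff)
  have "\<one>\<^bsub>ZFact (int (2 ^ m))\<^esub> \<otimes>\<^bsub>ZFact (int (2 ^ m))\<^esub> \<one>\<^bsub>ZFact (int (2 ^ m))\<^esub> = \<one>\<^bsub>ZFact (int (2 ^ m))\<^esub>"
    by (simp add: ZFact_one_eq ZFact_mult)
  with False Z Z' U show ?thesis
    by (intro iso_if_common_parametrization[where p = "\<lambda>_ :: unit. (\<zero>\<^bsub>ZFact 1\<^esub>, \<zero>\<^bsub>ZFact 1\<^esub>)"
        and q = "\<lambda>_. \<one>\<^bsub>ZFact (int (2 ^ m))\<^esub>" and f = "\<lambda>_ _. ()"])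
      (auto simp: twopow_units_ring_def RDirProd_carrier RDirProd_add units_of_def)
qed

text \<open>
  The first factor is $\mathbb{Z}_2$ or $\mathbb{Z}_1$ and contributes a single unit. This is why
  the iteration continues with a cyclic ring whose exponent is smaller by 2.
\<close>
lemma units_twopow_units_ring:
  "units_of (twopow_units_ring m) \<cong> units_of (ZFact (int (2 ^ (m - 2))))"
  unfolding twopow_units_ring_def
  by (intro units_RDirProd_iso Units_ZFact_eq_one) (auto simp: ZFact_one_eq ZFact_mult)

lemma cring_twopow_units_ring: "cring (twopow_units_ring m)"
  unfolding twopow_units_ring_def by (intro RDirProd_cring ZFact_is_cring)

section \<open>Products of residue rings determined by their additive group\<close>

lemma trivial_rings_isomorphic:
  assumes "ring R" "ring S" "card (carrier R) = 1" "card (carrier S) = 1"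
  shows "R \<simeq> S"
proof -
  interpret R: ring R by fact
  interpret S: ring S by fact
  have "carrier R = {\<zero>\<^bsub>R\<^esub>}" "carrier S = {\<zero>\<^bsub>S\<^esub>}"
    using assms(3,4) R.zero_closed S.zero_closed by (metis card_1_singletonE singletonD)+
  then have "(\<lambda>_. \<zero>\<^bsub>S\<^esub>) \<in> ring_iso R S"
    using R.one_closed S.one_closed by (auto simp: ring_iso_def ring_hom_def bij_betw_def)
  then show ?thesis
    by (auto simp: is_ring_iso_def)
qed

lemma RDirProd_iso_cong:
  assumes "R \<simeq> R'" "S \<simeq> S'"
  shows "RDirProd R S \<simeq> RDirProd R' S'"
  using assms RDirProd_iso6 unfolding is_ring_iso_def by fast

lemma RDirProd_commute_iso: "RDirProd R S \<simeq> RDirProd S R"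
  using RDirProd_iso1 unfolding is_ring_iso_def by fast

lemma RDirProd_trivial_left_iso:
  assumes "ring R" "ring S" "card (carrier R) = 1"
  shows "RDirProd R S \<simeq> S"
proof -
  interpret R: ring R by fact
  interpret S: ring S by fact
  have "carrier R = {\<one>\<^bsub>R\<^esub>}"
    using assms(3) R.one_closed by (metis card_1_singletonE singletonD)
  then have "snd \<in> ring_iso (RDirProd R S) S"
    by (auto simp: ring_iso_def ring_hom_def bij_betw_def inj_on_def RDirProd_carrier RDirProd_mult
        RDirProd_add RDirProd_one)
  then show ?thesis
    by (auto simp: is_ring_iso_def)
qed

abbreviation residue_product :: "nat list \<Rightarrow> int set list ring" where
  "residue_product ns \<equiv> RDirProd_list (map (\<lambda>n. ZFact (int n)) ns)"

lemma ring_residue_product: "ring (residue_product ns)"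
  by (rule RDirProd_list_is_ring) (simp add: ZFact_ring)

lemma residue_product_Cons_iso:
  "residue_product (n # ns) \<simeq> RDirProd (ZFact (int n)) (residue_product ns)"
  using RDirProd_list_iso2[of "ZFact (int n)" "map (\<lambda>n. ZFact (int n)) ns"]
  by (auto simp: is_ring_iso_def)

lemma card_residue_product:
  assumes "\<forall>n\<in>set ns. n \<ge> 1"
  shows "card (carrier (residue_product ns)) = prod_list ns"
  using assms
proof (induction ns)
  case (Cons n ns)
  then show ?case
    using ring_iso_same_card[OF residue_product_Cons_iso[of n ns]]
    by (simp add: RDirProd_carrier card_cartesian_product card_ZFact del: list.map)
qed simp

lemma prod_list_dvd:
  "n \<in> set ns \<Longrightarrow> n dvd prod_list (ns :: nat list)"
  by (induction ns) auto

text \<open>If one modulus already accounts for the whole order, all other factors are zero rings.\<close>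
lemma residue_product_eq_cyclic:
  assumes "N \<in> set ns" "prod_list ns = N" "N \<ge> 1"
  shows "residue_product ns \<simeq> ZFact (int N)"
  using assms(1,2)
proof (induction ns)
  case (Cons n ns)
  have pos: "\<forall>k\<in>set (n # ns). k \<ge> 1"
    using Cons.prems(2) assms(3) by (metis One_nat_def Suc_leI gr0I not_one_le_zero prod_list_zero_iff)
  show ?case
  proof (cases "n = N")
    case True
    then have "prod_list ns = 1"
      using Cons.prems(2) assms(3) by simp
    then have "card (carrier (residue_product ns)) = 1"
      using card_residue_product[of ns] pos by simp
    then have "RDirProd (residue_product ns) (ZFact (int n)) \<simeq> ZFact (int n)"
      by (intro RDirProd_trivial_left_iso ring_residue_product ZFact_ring)
    then have "RDirProd (ZFact (int n)) (residue_product ns) \<simeq> ZFact (int n)"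
      by (rule ring_iso_trans[OF RDirProd_commute_iso])
    then have "residue_product (n # ns) \<simeq> ZFact (int n)"
      by (rule ring_iso_trans[OF residue_product_Cons_iso])
    with True show ?thesis by simp
  next
    case False
    then have "N dvd prod_list ns"
      using Cons.prems(1) by (simp add: prod_list_dvd)
    moreover have "prod_list ns \<noteq> 0"
      using pos by (auto simp: prod_list_zero_iff)
    moreover obtain c where "prod_list ns = N * c"
      using \<open>N dvd prod_list ns\<close> by blast
    ultimately have "n = 1" "prod_list ns = N"
      using Cons.prems(2) assms(3) by auto
    then have "residue_product ns \<simeq> ZFact (int N)"
      using Cons.IH Cons.prems(1) False by simp
    moreover have "RDirProd (ZFact (int n)) (residue_product ns) \<simeq> residue_product ns"
      using \<open>n = 1\<close> card_ZFact[of 1] 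
      by (intro RDirProd_trivial_left_iso ring_residue_product ZFact_ring) simp
    ultimately show ?thesis
      by (intro ring_iso_trans[OF residue_product_Cons_iso]) (rule ring_iso_trans)
  qed
qed simp

lemma prime_prod_list_mem:
  assumes "prod_list ns = p" "Factorial_Ring.prime p"
  shows "p \<in> set (ns :: nat list)"
  using assms(1)
proof (induction ns)
  case Nil
  with assms(2) show ?case
    using not_prime_1 by (metis prod_list.Nil)
next
  case (Cons n ns)
  then have p: "p = n * prod_list ns" by simp
  then have "n dvd p" by simp
  then have "n = 1 \<or> n = p"
    using assms(2) prime_nat_iff by blast
  with p Cons.IH show ?case by auto
qed

text \<open>
  Beside the modulus $N$ there is only a prime left to distribute, so exactly one other modulus
  differs from 1, and it is that prime.
\<close>
lemma residue_product_eq_prime_times_cyclic: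
  assumes "N \<in> set ns" "prod_list ns = p * N" "N \<ge> 1" and p: "Factorial_Ring.prime p"
  shows "residue_product ns \<simeq> RDirProd (ZFact (int p)) (ZFact (int N))"
  using assms(1,2)
proof (induction ns)
  case (Cons n ns)
  have "p > 0"
    using p by (rule prime_gt_0_nat)
  show ?case
  proof (cases "n = N")
    case True
    then have prod: "prod_list ns = p"
      using Cons.prems(2) assms(3) by simp
    then have "p \<in> set ns"
      using p by (intro prime_prod_list_mem) auto
    then have "residue_product ns \<simeq> ZFact (int p)"
      using prod \<open>p > 0\<close> by (intro residue_product_eq_cyclic) auto
    then have "RDirProd (ZFact (int n)) (residue_product ns) \<simeq> RDirProd (ZFact (int n)) (ZFact (int p))"
      by (intro RDirProd_iso_cong ring_iso_refl)
    then have "residue_product (n # ns) \<simeq> RDirProd (ZFact (int n)) (ZFact (int p))"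
      by (rule ring_iso_trans[OF residue_product_Cons_iso])
    then have "residue_product (n # ns) \<simeq> RDirProd (ZFact (int p)) (ZFact (int n))"
      using RDirProd_commute_iso by (rule ring_iso_trans)
    with True show ?thesis by simp
  next
    case False
    then have N: "N \<in> set ns"
      using Cons.prems(1) by simp
    then obtain c where c: "prod_list ns = N * c"
      using prod_list_dvd by (metis dvdE)
    then have nc: "n * c = p"
      using Cons.prems(2) assms(3) by (simp add: mult.commute mult.left_commute)
    then have "n dvd p" by auto
    then have "n = 1 \<or> n = p"
      using p prime_nat_iff by blast
    with nc \<open>p > 0\<close> consider "n = 1" "c = p" | "n = p" "c = 1"
      by auto
    then show ?thesis
    proof cases
      case 1
      then have IH: "residue_product ns \<simeq> RDirProd (ZFact (int p)) (ZFact (int N))"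
        using Cons.IH N c by (simp add: mult.commute)
      have "RDirProd (ZFact (int n)) (residue_product ns) \<simeq> residue_product ns"
        using \<open>n = 1\<close> card_ZFact[of 1]
        by (intro RDirProd_trivial_left_iso ring_residue_product ZFact_ring) simp
      then have "RDirProd (ZFact (int n)) (residue_product ns) \<simeq>
          RDirProd (ZFact (int p)) (ZFact (int N))"
        using IH by (rule ring_iso_trans)
      then show ?thesis
        by (rule ring_iso_trans[OF residue_product_Cons_iso])
    next
      case 2
      then have "residue_product ns \<simeq> ZFact (int N)"
        using N c assms(3) by (intro residue_product_eq_cyclic) auto
      then have "RDirProd (ZFact (int n)) (residue_product ns) \<simeq> RDirProd (ZFact (int n)) (ZFact (int N))"
        by (intro RDirProd_iso_cong ring_iso_refl)
      then have "residue_product (n # ns) \<simeq> RDirProd (ZFact (int n)) (ZFact (int N))"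
        by (rule ring_iso_trans[OF residue_product_Cons_iso])
      with \<open>n = p\<close> show ?thesis by simp
    qed
  qed
qed simp

text \<open>
  In these terms, the exponent of a finite group is the least positive number that annihilates
  it. The predicate passes to direct products without the computation of a least common multiple.
\<close>
definition annihilates :: "nat \<Rightarrow> ('a, 'b) monoid_scheme \<Rightarrow> bool" where
  "annihilates N G \<longleftrightarrow> (\<forall>x\<in>carrier G. x [^]\<^bsub>G\<^esub> N = \<one>\<^bsub>G\<^esub>)"

lemma annihilates_iso:
  assumes "group G" "group H" "G \<cong> H" "annihilates N G"
  shows "annihilates N H"
proof -
  obtain h where h: "h \<in> hom G H" "h ` carrier G = carrier H"
    using assms(3) by (auto simp: is_iso_def iso_def bij_betw_def)
  interpret group_hom G H h
    using assms(1,2) h(1) by (simp add: group_hom_def group_hom_axioms_def)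
  show ?thesis
    unfolding annihilates_def h(2)[symmetric]
    using assms(4) by (auto simp: annihilates_def simp flip: hom_nat_pow)
qed

lemma annihilates_iso_iff:
  assumes "group G" "group H" "G \<cong> H"
  shows "annihilates N G \<longleftrightarrow> annihilates N H"
  using assms annihilates_iso group.iso_sym by metis

lemma annihilates_DirProd:
  assumes "group G" "group H"
  shows "annihilates N (G \<times>\<times> H) \<longleftrightarrow> annihilates N G \<and> annihilates N H"
proof -
  interpret G: group G by fact
  interpret H: group H by fact
  have pow: "(x, y) [^]\<^bsub>G \<times>\<times> H\<^esub> N = (x [^]\<^bsub>G\<^esub> N, y [^]\<^bsub>H\<^esub> N)" for x y and N :: nat
    by (induction N) auto
  show ?thesis
    using G.one_closed H.one_closed by (auto simp: annihilates_def pow)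
qed

lemma group_add_monoid: "ring R \<Longrightarrow> group (add_monoid R)"
  by (intro abelian_group.a_group ring.is_abelian_group)

lemma annihilates_ZFact: "annihilates N (add_monoid (ZFact n)) \<longleftrightarrow> n dvd int N"
proof -
  have pow: "ZMod n a [^]\<^bsub>add_monoid (ZFact n)\<^esub> N = ZMod n (a * int N)" for a and N :: nat
    by (induction N) (auto simp: nat_pow_def ZFact_zero_eq ZFact_add algebra_simps)
  have "annihilates N (add_monoid (ZFact n)) \<longleftrightarrow>
      (\<forall>a. ZMod n a [^]\<^bsub>add_monoid (ZFact n)\<^esub> N = \<zero>\<^bsub>ZFact n\<^esub>)"
    by (simp add: annihilates_def ZFact_carrier)
  also have "\<dots> \<longleftrightarrow> (\<forall>a. n dvd a * int N)"
    unfolding pow by (simp add: ZFact_zero_eq ZMod_eq_cong cong_0_iff)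
  also have "\<dots> \<longleftrightarrow> n dvd int N"
    by (metis dvd_mult mult_1)
  finally show ?thesis .
qed

lemma annihilates_residue_product:
  "annihilates N (add_monoid (residue_product ns)) \<longleftrightarrow> (\<forall>n\<in>set ns. n dvd N)"
proof (induction ns)
  case Nil
  have "group (add_monoid (residue_product []))"
    by (intro group_add_monoid ring_residue_product)
  moreover have "carrier (add_monoid (residue_product [])) = {\<one>\<^bsub>add_monoid (residue_product [])\<^esub>}"
    by (simp add: monoid.defs)
  ultimately have "annihilates N (add_monoid (residue_product []))"
    unfolding annihilates_def by (metis group.is_monoid monoid.nat_pow_one singletonD)
  then show ?case
    by simp
next
  case (Cons n ns)
  have "annihilates N (add_monoid (residue_product (n # ns))) \<longleftrightarrow>
      annihilates N (add_monoid (RDirProd (ZFact (int n)) (residue_product ns)))"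
    by (intro annihilates_iso_iff group_add_monoid ring_residue_product RDirProd_ring ZFact_ring
        ring_iso_imp_add_iso residue_product_Cons_iso)
  also have "\<dots> \<longleftrightarrow> annihilates N (add_monoid (ZFact (int n))) \<and>
      annihilates N (add_monoid (residue_product ns))"
    unfolding RDirProd_add_monoid
    by (intro annihilates_DirProd group_add_monoid ring_residue_product ZFact_ring)
  finally show ?case
    unfolding Cons.IH annihilates_ZFact by simp
qed

text \<open>
  The independence of the ring structure from the decomposition, for the groups that occur here.
  The order alone settles $m \le 2$. For $m > 2$ all moduli divide $2^{m-2}$. If none of
  them were equal to it, all would divide $2^{m-3}$, and this number would annihilate
  the group.
\<close>
lemma residue_product_eq_twopow_units_ring:
  assumes pos: "\<forall>n\<in>set ns. n \<ge> 1"
    and iso: "add_monoid (residue_product ns) \<cong> add_monoid (twopow_units_ring m)"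
  shows "residue_product ns \<simeq> twopow_units_ring m"
proof -
  have V: "ring (twopow_units_ring m)"
    using cring_twopow_units_ring cring.axioms(1) by blast
  have "card (carrier (residue_product ns)) = card (carrier (twopow_units_ring m))"
    using iso by (auto simp: is_iso_def iso_def dest: bij_betw_same_card)
  moreover have card: "card (carrier (twopow_units_ring m)) = (if m \<ge> 2 then 2 else 1) * 2 ^ (m - 2)"
    unfolding twopow_units_ring_def RDirProd_carrier card_cartesian_product
    by (subst (1 2) card_ZFact) auto
  ultimately have prod: "prod_list ns = (if m \<ge> 2 then 2 else 1) * 2 ^ (m - 2)"
    using card_residue_product[OF pos] by simp
  have ann: "(\<forall>n\<in>set ns. n dvd N) \<longleftrightarrow> 2 dvd N \<and> 2 ^ (m - 2) dvd N" if "m \<ge> 2" for N :: nat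
  proof -
    have "(\<forall>n\<in>set ns. n dvd N) \<longleftrightarrow> annihilates N (add_monoid (twopow_units_ring m))"
      unfolding annihilates_residue_product[symmetric]
      by (intro annihilates_iso_iff group_add_monoid ring_residue_product V iso)
    also have "\<dots> \<longleftrightarrow> int 2 dvd int N \<and> int (2 ^ (m - 2)) dvd int N"
      unfolding twopow_units_ring_def RDirProd_add_monoid
      using that by (simp only: if_True annihilates_ZFact
          annihilates_DirProd[OF group_add_monoid[OF ZFact_ring] group_add_monoid[OF ZFact_ring]])
    finally show ?thesis
      unfolding int_dvd_int_iff .
  qed
  consider "m < 2" | "m = 2" | "m > 2" by linarith
  then show ?thesis
  proof cases
    case 1
    then show ?thesis
      using card prod card_residue_product[OF pos]
      by (intro trivial_rings_isomorphic ring_residue_product V) auto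
  next
    case 2
    then have "prod_list ns = 2"
      using prod by simp
    then have "2 \<in> set ns"
      by (rule prime_prod_list_mem) simp
    then have "residue_product ns \<simeq> ZFact (int 2)"
      using \<open>prod_list ns = 2\<close> by (intro residue_product_eq_cyclic) auto
    moreover have "RDirProd (ZFact (int 1)) (ZFact (int 2)) \<simeq> ZFact (int 2)"
      by (intro ZFact_ring RDirProd_trivial_left_iso card_ZFact) simp
    then have "ZFact (int 2) \<simeq> RDirProd (ZFact (int 1)) (ZFact (int 2))"
      by (intro ring_iso_sym[OF RDirProd_ring] ZFact_ring)
    moreover have "twopow_units_ring m = RDirProd (ZFact (int 2)) (ZFact (int 1))"
      using 2 by (simp add: twopow_units_ring_def)
    moreover have "RDirProd (ZFact (int 1)) (ZFact (int 2)) \<simeq> RDirProd (ZFact (int 2)) (ZFact (int 1))"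
      by (rule RDirProd_commute_iso)
    ultimately show ?thesis
      by (metis ring_iso_trans)
  next
    case 3
    have "2 ^ (m - 2) \<in> set ns"
    proof (rule ccontr)
      assume notin: "2 ^ (m - 2) \<notin> set ns"
      have "n dvd 2 ^ (m - 3)" if n: "n \<in> set ns" for n
      proof -
        have "n dvd 2 ^ (m - 2)"
          using ann[of "2 ^ (m - 2)"] 3 n by auto
        then obtain j where j: "j \<le> m - 2" "n = 2 ^ j"
          by (auto simp: divides_primepow_nat)
        then have "j \<le> m - 3"
          using notin n 3 by (cases "j = m - 2") auto
        with j show ?thesis
          by (simp add: le_imp_power_dvd)
      qed
      then have "2 ^ (m - 2) dvd (2 :: nat) ^ (m - 3)"
        using ann[of "2 ^ (m - 3)"] 3 by auto
      with 3 show False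
        by (auto dest!: power_dvd_imp_le)
    qed
    then show ?thesis
      using residue_product_eq_prime_times_cyclic[of "2 ^ (m - 2)" ns 2] prod 3
      by (simp add: twopow_units_ring_def)
  qed
qed

section \<open>Iterating the units\<close>

lemma unit_ring_unique:
  assumes "unit_ring T S" "units_of T \<cong> add_monoid (twopow_units_ring m)"
  shows "S \<simeq> twopow_units_ring m"
proof -
  obtain ns where S: "cring S" "add_monoid S = units_of T" "\<forall>n\<in>set ns. n \<ge> 1" "S \<simeq> residue_product ns"
    using assms(1) unfolding unit_ring_def by blast
  have "ring S"
    using S(1) cring.axioms(1) by blast
  then have "add_monoid (residue_product ns) \<cong> add_monoid S"
    using S(4) by (intro ring_iso_imp_add_iso ring_iso_sym[of S])
  then have "add_monoid (residue_product ns) \<cong> add_monoid (twopow_units_ring m)"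
    unfolding S(2) using assms(2) by (rule iso_trans)
  then have "residue_product ns \<simeq> twopow_units_ring m"
    by (rule residue_product_eq_twopow_units_ring[OF S(3)])
  with S(4) show ?thesis
    by (rule ring_iso_trans)
qed

text \<open>
  The multiplication of a model \<^term>\<open>P\<close> is carried over to the units of \<^term>\<open>T\<close>. The addition
  is taken to be the multiplication of \<^term>\<open>T\<close> itself, not its transport, since the two
  need to agree only on the units and \<^const>\<open>unit_ring\<close> compares them as total functions.
\<close>
lemma unit_ring_exists:
  assumes "ring T" "add_monoid P \<cong> units_of T" "cring P"
    and "\<forall>n\<in>set ns. n \<ge> 1" "P \<simeq> residue_product ns"
  shows "\<exists>S. unit_ring T S"
proof -
  interpret T: ring T by fact
  interpret P: cring P by fact
  obtain f where f: "f \<in> iso (add_monoid P) (units_of T)"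
    using assms(2) by (auto simp: is_iso_def)
  then have bij: "bij_betw f (carrier P) (Units T)"
    and add: "\<And>x y. x \<in> carrier P \<Longrightarrow> y \<in> carrier P \<Longrightarrow> f (x \<oplus>\<^bsub>P\<^esub> y) = f x \<otimes>\<^bsub>T\<^esub> f y"
    by (auto simp: iso_def hom_def units_of_def)
  have zero: "f \<zero>\<^bsub>P\<^esub> = \<one>\<^bsub>T\<^esub>"
    using hom_one[of f "add_monoid P" "units_of T"] f T.units_group P.add.is_group
    by (simp add: iso_def units_of_def)
  define g where "g = inv_into (carrier P) f"
  have g: "g (f x) = x" if "x \<in> carrier P" for x
    using that bij by (simp add: g_def bij_betw_def)
  define S :: "'a ring" where "S = \<lparr>carrier = Units T, monoid.mult = (\<lambda>a b. f (g a \<otimes>\<^bsub>P\<^esub> g b)), one = f \<one>\<^bsub>P\<^esub>,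
    ring.zero = \<one>\<^bsub>T\<^esub>, ring.add = monoid.mult T\<rparr>"
  have h: "f \<in> ring_iso P S"
    using bij by (auto simp: ring_iso_def ring_hom_def S_def add g bij_betw_def)
  then have "cring (S\<lparr>ring.zero := f \<zero>\<^bsub>P\<^esub>\<rparr>)"
    by (rule P.ring_iso_imp_img_cring)
  moreover have "S\<lparr>ring.zero := f \<zero>\<^bsub>P\<^esub>\<rparr> = S"
    by (simp add: S_def zero)
  ultimately have "cring S" by simp
  moreover have "S \<simeq> P"
    using h by (intro ring_iso_sym[OF P.ring_axioms]) (auto simp: is_ring_iso_def)
  then have "S \<simeq> residue_product ns"
    using assms(5) by (rule ring_iso_trans)
  moreover have "add_monoid S = units_of T"
    by (simp add: S_def units_of_def)
  ultimately show ?thesis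
    using assms(4) unfolding unit_ring_def by blast
qed

lemma twopow_units_ring_residue_product:
  "twopow_units_ring m \<simeq> residue_product [if m \<ge> 2 then 2 else 1, 2 ^ (m - 2)]"
proof -
  have "RDirProd (ZFact (int k)) (ZFact (int l)) \<simeq> residue_product [k, l]" for k l
  proof -
    have "RDirProd (ZFact (int k)) (ZFact (int l)) \<simeq> RDirProd (ZFact (int k)) (residue_product [l])"
      using RDirProd_list_iso3[of "ZFact (int l)"]
      by (intro RDirProd_iso_cong ring_iso_refl) (auto simp: is_ring_iso_def)
    moreover have "RDirProd (ZFact (int k)) (residue_product [l]) \<simeq> residue_product [k, l]"
      using RDirProd_list_iso1[of "ZFact (int k)" "[ZFact (int l)]"] by (auto simp: is_ring_iso_def)
    ultimately show ?thesis
      by (rule ring_iso_trans)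
  qed
  then show ?thesis
    unfolding twopow_units_ring_def .
qed

text \<open>
  The units of $U^k(\mathbb{Z}_{2^\alpha})$ are those of $\mathbb{Z}_{2^{\alpha-2k}}$. This is the
  part that is carried through the induction, and it holds from $k = 0$ on. The ring structure is
  pinned down only once $U$ has been applied; its index refers to the exponent before the last
  application.
\<close>
lemma iterated_unit_ring_twopow:
  assumes "iterated_unit_ring k (ZFact (int (2 ^ \<alpha>))) S"
  shows "cring S \<and> units_of S \<cong> units_of (ZFact (int (2 ^ (\<alpha> - 2 * k)))) \<and>
    (k > 0 \<longrightarrow> S \<simeq> twopow_units_ring (\<alpha> - 2 * (k - 1)))"
  using assms
proof (induction k arbitrary: S)
  case 0
  then show ?case
    by (simp add: ZFact_is_cring iso_refl)
next
  case (Suc k)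
  let ?m = "\<alpha> - 2 * k"
  obtain T where T: "iterated_unit_ring k (ZFact (int (2 ^ \<alpha>))) T" "unit_ring T S"
    using Suc.prems by auto
  have "add_monoid (twopow_units_ring ?m) \<cong> units_of (ZFact (int (2 ^ ?m)))"
    by (rule units_ZFact_twopow_iso)
  then have "units_of (ZFact (int (2 ^ ?m))) \<cong> add_monoid (twopow_units_ring ?m)"
    by (rule group.iso_sym[OF group_add_monoid[OF cring.axioms(1)[OF cring_twopow_units_ring]]])
  with conjunct1[OF conjunct2[OF Suc.IH[OF T(1)]]]
  have "units_of T \<cong> add_monoid (twopow_units_ring ?m)"
    by (rule iso_trans)
  with T(2) have S: "S \<simeq> twopow_units_ring ?m"
    by (rule unit_ring_unique)
  moreover have "cring S"
    using T(2) unfolding unit_ring_def by blast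
  moreover have "units_of S \<cong> units_of (twopow_units_ring ?m)"
    by (intro ring_iso_imp_units_iso cring.axioms(1) S \<open>cring S\<close> cring_twopow_units_ring)
  then have "units_of S \<cong> units_of (ZFact (int (2 ^ (?m - 2))))"
    using units_twopow_units_ring by (rule iso_trans)
  moreover have "?m - 2 = \<alpha> - 2 * Suc k"
    by simp
  ultimately show ?case
    by simp
qed

lemma iterated_unit_ring_twopow_exists:
  "\<exists>S. iterated_unit_ring k (ZFact (int (2 ^ \<alpha>))) S"
proof (induction k)
  case (Suc k)
  let ?m = "\<alpha> - 2 * k"
  obtain T where T: "iterated_unit_ring k (ZFact (int (2 ^ \<alpha>))) T"
    using Suc.IH by blast
  note T' = iterated_unit_ring_twopow[OF T]
  then have "ring T"
    by (intro cring.axioms(1)) blast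
  then interpret T: ring T .
  have "units_of (ZFact (int (2 ^ ?m))) \<cong> units_of T"
    by (rule group.iso_sym[OF T.units_group conjunct1[OF conjunct2[OF T']]])
  with units_ZFact_twopow_iso have "add_monoid (twopow_units_ring ?m) \<cong> units_of T"
    by (rule iso_trans)
  then have "\<exists>S. unit_ring T S"
    by (rule unit_ring_exists[OF \<open>ring T\<close> _ cring_twopow_units_ring _
          twopow_units_ring_residue_product]) simp
  with T show ?case
    by auto
qed auto

theorem theorem5:
  fixes k \<alpha> :: nat
  assumes "k > 0" and "\<alpha> > 0"
  shows "(\<exists>S. iterated_unit_ring k (ZFact (2 ^ \<alpha>)) S) \<and>
    (\<forall>S. iterated_unit_ring k (ZFact (2 ^ \<alpha>)) S \<longrightarrow>
       (\<alpha> > 2 * k \<longrightarrow> S \<simeq> RDirProd (ZFact 2) (ZFact (2 ^ (\<alpha> - 2 * k)))) \<and>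
       (\<alpha> = 2 * k \<longrightarrow> S \<simeq> ZFact 2) \<and>
       (\<alpha> < 2 * k \<longrightarrow> S \<simeq> ZFact 1))"
proof (intro conjI allI impI)
  show "\<exists>S. iterated_unit_ring k (ZFact (2 ^ \<alpha>)) S"
    using iterated_unit_ring_twopow_exists[of k \<alpha>] by simp
next
  fix S
  assume S: "iterated_unit_ring k (ZFact (2 ^ \<alpha>)) S"
  \<comment> \<open>The ring arises from the units modulo $2^{\alpha - 2(k-1)}$. The three cases
    correspond to this exponent being above 2, equal to 2 and below 2.\<close>
  let ?m = "\<alpha> - 2 * (k - 1)"
  have iso: "S \<simeq> twopow_units_ring ?m"
    using iterated_unit_ring_twopow[of k \<alpha> S] S \<open>k > 0\<close> by simp
  have shift: "?m - 2 = \<alpha> - 2 * k"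
    using \<open>k > 0\<close> by linarith
  have trivial_factor: "RDirProd (ZFact 1) (ZFact n) \<simeq> ZFact n" for n
    using card_ZFact[of 1] by (intro RDirProd_trivial_left_iso ZFact_ring) simp
  {
    assume "\<alpha> > 2 * k"
    then have "?m \<ge> 2"
      using shift by linarith
    then have "twopow_units_ring ?m = RDirProd (ZFact 2) (ZFact (2 ^ (\<alpha> - 2 * k)))"
      unfolding twopow_units_ring_def shift by simp
    then show "S \<simeq> RDirProd (ZFact 2) (ZFact (2 ^ (\<alpha> - 2 * k)))"
      using iso by simp
  next
    assume "\<alpha> = 2 * k"
    then have "twopow_units_ring ?m = RDirProd (ZFact 2) (ZFact 1)"
      using shift \<open>k > 0\<close> by (auto simp: twopow_units_ring_def)
    then show "S \<simeq> ZFact 2"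
      using iso by (auto intro: ring_iso_trans[OF _ ring_iso_trans[OF RDirProd_commute_iso trivial_factor]])
  next
    assume "\<alpha> < 2 * k"
    then have "twopow_units_ring ?m = RDirProd (ZFact 1) (ZFact 1)"
      using shift by (auto simp: twopow_units_ring_def)
    then show "S \<simeq> ZFact 1"
      using iso by (auto intro: ring_iso_trans[OF _ trivial_factor])
  }
qed

end
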